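(* Let $(X,\kappa)$ be a finite digital image with the approximate fixed point property (AFPP). Let $v \ge 1$ be an integer and let $a_i \le b_i$ be integers for $i = 1,\dots,v$. Then the digital image $\left(X \times \prod_{i=1}^v [a_i,b_i]_{\mathbb{Z}},\, NP(\kappa,c_v)\right)$ has the AFPP.
   Context: A digital image $(X,\kappa)$ is a set $X$ (of lattice points in some $\mathbb{Z}^n$) together with an adjacency relation $\kappa$ on $X$, i.e., a symmetric irreflexive relation. Write $x \leftrightarrow_\kappa y$ if $x,y$ are $\kappa$-adjacent. A subset $A\subset X$ is $\kappa$-connected if for all $a,b \in A$ there is a sequence $a=x_0,\dots,x_k=b$ in $A$ with $x_i \leftrightarrow_\kappa x_{i+1}$ or $x_i = x_{i+1}$ for $0\le i<k$. A function $f: X \to X$ is $\kappa$-continuous if it maps $\kappa$-connected subsets to $\kappa$-connected subsets (equivalently, $x \leftrightarrow_\kappa x'$ implies that $f(x) \leftrightarrow_\kappa f(x')$ or $f(x) = f(x')$). $(X,\kappa)$ has the AFPP if for every $\kappa$-continuous $f: X \to X$ there is a point $x\in X$ with $f(x) \leftrightarrow_\kappa x$ or $f(x) = x$. For integers $a \le b$, $[a,b]_{\mathbb{Z}} = \{t \in \mathbb{Z} : a \le t \le b\}$. For $1 \le u \le n$, distinct points $x,y\in\mathbb{Z}^n$ are $c_u$-adjacent if there are at most $u$ indices $i$ with $|x_i-y_i|=1$, and $x_j=y_j$ for all indices $j$ with $|x_j-y_j|\ne 1$. For digital images $(X,\kappa)$ and $(Y,\lambda)$, the normal product adjacency $NP(\kappa,\lambda)$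 on $X\times Y$ is: $(x,y)$ and $(x',y')$ are adjacent iff ($x \leftrightarrow_\kappa x'$ and $y=y'$), or ($x=x'$ and $y \leftrightarrow_\lambda y'$), or ($x \leftrightarrow_\kappa x'$ and $y \leftrightarrow_\lambda y'$). *)

theory Defs
  imports "HOL-Library.FuncSet"
begin

(* A point of Z^n is an extensional function on the index set {1..n} (it is undefined outside),
   so that two points are equal iff their n coordinates are. *)
definition int_lattice :: "nat \<Rightarrow> (nat \<Rightarrow> int) set" where
  "int_lattice n = {1..n} \<rightarrow>\<^sub>E UNIV"

(* Adjacencies are binary predicates; only their values on the carrier set matter. *)
definition adjacency_on :: "'a set \<Rightarrow> ('a \<Rightarrow> 'a \<Rightarrow> bool) \<Rightarrow> bool" where
  "adjacency_on X \<kappa> \<longleftrightarrow> symp_on X \<kappa> \<and> irreflp_on X \<kappa>"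

definition digital_image :: "nat \<Rightarrow> (nat \<Rightarrow> int) set \<Rightarrow> ((nat \<Rightarrow> int) \<Rightarrow> (nat \<Rightarrow> int) \<Rightarrow> bool) \<Rightarrow> bool" where
  "digital_image n X \<kappa> \<longleftrightarrow> X \<subseteq> int_lattice n \<and> adjacency_on X \<kappa>"

(* The notions below use only a carrier and its adjacency. They are polymorphic so that they apply
   both to X, a subset of Z^n, and to products, whose points are pairs in Z^n x Z^v. *)

definition dig_connected :: "('a \<Rightarrow> 'a \<Rightarrow> bool) \<Rightarrow> 'a set \<Rightarrow> bool" where
  "dig_connected \<kappa> A \<longleftrightarrow>
     (\<forall>a\<in>A. \<forall>b\<in>A. \<exists>(k::nat) x. x 0 = a \<and> x k = b \<and> (\<forall>i\<le>k. x i \<in> A) \<and>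
        (\<forall>i<k. \<kappa> (x i) (x (Suc i)) \<or> x i = x (Suc i)))"

definition dig_continuous :: "'a set \<Rightarrow> ('a \<Rightarrow> 'a \<Rightarrow> bool) \<Rightarrow> ('a \<Rightarrow> 'a) \<Rightarrow> bool" where
  "dig_continuous X \<kappa> f \<longleftrightarrow> (\<forall>A\<subseteq>X. dig_connected \<kappa> A \<longrightarrow> dig_connected \<kappa> (f ` A))"

definition AFPP :: "'a set \<Rightarrow> ('a \<Rightarrow> 'a \<Rightarrow> bool) \<Rightarrow> bool" where
  "AFPP X \<kappa> \<longleftrightarrow>
     (\<forall>f \<in> X \<rightarrow> X. dig_continuous X \<kappa> f \<longrightarrow> (\<exists>x\<in>X. \<kappa> (f x) x \<or> f x = x))"

definition c_adj :: "nat \<Rightarrow> nat \<Rightarrow> (nat \<Rightarrow> int) \<Rightarrow> (nat \<Rightarrow> int) \<Rightarrow> bool" where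
  "c_adj n u x y \<longleftrightarrow>
     x \<in> int_lattice n \<and> y \<in> int_lattice n \<and> x \<noteq> y \<and>
     card {i\<in>{1..n}. \<bar>x i - y i\<bar> = 1} \<le> u \<and>
     (\<forall>j\<in>{1..n}. \<bar>x j - y j\<bar> \<noteq> 1 \<longrightarrow> x j = y j)"

definition NP :: "('a \<Rightarrow> 'a \<Rightarrow> bool) \<Rightarrow> ('b \<Rightarrow> 'b \<Rightarrow> bool) \<Rightarrow> 'a \<times> 'b \<Rightarrow> 'a \<times> 'b \<Rightarrow> bool" where
  "NP \<kappa> l = (\<lambda>(x, y) (x', y').
     (\<kappa> x x' \<and> y = y') \<or> (x = x' \<and> l y y') \<or> (\<kappa> x x' \<and> l y y'))"

definition int_box :: "nat \<Rightarrow> (nat \<Rightarrow> int) \<Rightarrow> (nat \<Rightarrow> int) \<Rightarrow> (nat \<Rightarrow> int) set" where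
  "int_box v a b = (\<Pi>\<^sub>E i\<in>{1..v}. {a i..b i})"

lemma digital_image_box: "digital_image v (int_box v a b) (c_adj v u)"
  unfolding digital_image_def adjacency_on_def
proof (intro conjI)
  show "int_box v a b \<subseteq> int_lattice v"
    unfolding int_box_def int_lattice_def by (rule PiE_mono) auto
  show "symp_on (int_box v a b) (c_adj v u)"
  proof (rule symp_onI)
    fix x y assume "c_adj v u x y"
    moreover have "\<bar>y i - x i\<bar> = \<bar>x i - y i\<bar>" for i by (rule abs_minus_commute)
    ultimately show "c_adj v u y x" unfolding c_adj_def by auto
  qed
  show "irreflp_on (int_box v a b) (c_adj v u)"
    by (rule irreflp_onI) (simp add: c_adj_def)
qed

lemma adjacency_on_NP:
  assumes "adjacency_on X \<kappa>" "adjacency_on Y l"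
  shows "adjacency_on (X \<times> Y) (NP \<kappa> l)"
proof -
  have sym: "\<kappa> x x' \<Longrightarrow> \<kappa> x' x" if "x \<in> X" "x' \<in> X" for x x'
    using assms(1) that unfolding adjacency_on_def symp_on_def by blast
  have sym': "l y y' \<Longrightarrow> l y' y" if "y \<in> Y" "y' \<in> Y" for y y'
    using assms(2) that unfolding adjacency_on_def symp_on_def by blast
  have irr: "\<not> \<kappa> x x" if "x \<in> X" for x
    using assms(1) that unfolding adjacency_on_def irreflp_on_def by blast
  have irr': "\<not> l y y" if "y \<in> Y" for y
    using assms(2) that unfolding adjacency_on_def irreflp_on_def by blast
  have "symp_on (X \<times> Y) (NP \<kappa> l)"
  proof (rule symp_onI)
    fix p q assume pq: "p \<in> X \<times> Y" "q \<in> X \<times> Y" "NP \<kappa> l p q"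
    obtain x y x' y' where e: "p = (x, y)" "q = (x', y')" by (metis surj_pair)
    have m: "x \<in> X" "x' \<in> X" "y \<in> Y" "y' \<in> Y" using pq(1,2) unfolding e by blast+
    show "NP \<kappa> l q p"
      using pq(3) sym[OF m(1,2)] sym'[OF m(3,4)] unfolding e NP_def prod.case by blast
  qed
  moreover have "irreflp_on (X \<times> Y) (NP \<kappa> l)"
  proof (rule irreflp_onI)
    fix p assume p: "p \<in> X \<times> Y"
    obtain x y where e: "p = (x, y)" by (metis surj_pair)
    have m: "x \<in> X" "y \<in> Y" using p unfolding e by blast+
    show "\<not> NP \<kappa> l p p"
      using irr[OF m(1)] irr'[OF m(2)] unfolding e NP_def prod.case by blast
  qed
  ultimately show ?thesis unfolding adjacency_on_def by blast
qed

end

theory Submission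
  imports Defs
begin

text \<open>
  Call two points close if they are adjacent or equal, so that a digital image becomes a finite
  reflexive symmetric graph, the continuous maps are the graph homomorphisms, and the AFPP says that
  every endomorphism sends some point to a close one.

  The box can be shrunk to a point by repeatedly cutting off the top layer in every direction. One
  such cut is a map \<open>r\<close> with the property that everything close to \<open>x\<close> is also close to \<open>r x\<close> (a
  folding, in the sense of dismantlable graphs), and it suffices to show that a folding of \<open>V\<close> into
  \<open>W\<close> carries the AFPP from \<open>W\<close> back to \<open>V\<close> (lemma \<open>approx_fixed_folding\<close>).

  Composing an endomorphism of \<open>V\<close> with \<open>r\<close> is not enough for this: \<open>r (f p)\<close> close to \<open>p\<close> does not
  make \<open>f p\<close> close to \<open>p\<close>. Instead, let \<open>C\<close> be a minimal retract of \<open>V\<close>, with retraction \<open>\<rho>\<close>, that has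
  an endomorphism \<open>f\<close> without approximate fixed points. Minimality forces every such endomorphism of
  \<open>C\<close> to be onto, since otherwise an idempotent power of it would retract \<open>C\<close> to something smaller.
  If some \<open>x\<close> in \<open>C\<close> were dominated by another \<open>y\<close> in \<open>C\<close>, then applying \<open>f\<close> after moving \<open>x\<close> to \<open>y\<close>
  would give such an endomorphism that is not onto; so \<open>C\<close> has no dominated point. As
  \<open>\<rho> \<circ> r\<close> sends each \<open>x\<close> in \<open>C\<close> to a point dominating it, \<open>\<rho> \<circ> r\<close> is the identity on \<open>C\<close>.
  Hence \<open>r\<close> embeds \<open>C\<close> as a retract of \<open>W\<close>, and \<open>r \<circ> f \<circ> \<rho>\<close> is an endomorphism of \<open>W\<close> without
  approximate fixed points.
\<close>

section \<open>Endomorphisms without approximate fixed points\<close>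

definition graph_hom :: "('a \<Rightarrow> 'a \<Rightarrow> bool) \<Rightarrow> 'a set \<Rightarrow> 'a set \<Rightarrow> ('a \<Rightarrow> 'a) \<Rightarrow> bool" where
  "graph_hom R A B f \<longleftrightarrow> f \<in> A \<rightarrow> B \<and> (\<forall>x\<in>A. \<forall>y\<in>A. R x y \<longrightarrow> R (f x) (f y))"

definition approx_free :: "('a \<Rightarrow> 'a \<Rightarrow> bool) \<Rightarrow> 'a set \<Rightarrow> ('a \<Rightarrow> 'a) \<Rightarrow> bool" where
  "approx_free R A f \<longleftrightarrow> graph_hom R A A f \<and> (\<forall>x\<in>A. \<not> R (f x) x)"

definition graph_retract :: "('a \<Rightarrow> 'a \<Rightarrow> bool) \<Rightarrow> 'a set \<Rightarrow> 'a set \<Rightarrow> bool" where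
  "graph_retract R A C \<longleftrightarrow> C \<subseteq> A \<and> (\<exists>\<rho>. graph_hom R A C \<rho> \<and> (\<forall>x\<in>C. \<rho> x = x))"

lemma graph_hom_mem: "graph_hom R A B f \<Longrightarrow> x \<in> A \<Longrightarrow> f x \<in> B"
  by (auto simp: graph_hom_def)

lemma graph_hom_rel: "graph_hom R A B f \<Longrightarrow> x \<in> A \<Longrightarrow> y \<in> A \<Longrightarrow> R x y \<Longrightarrow> R (f x) (f y)"
  by (auto simp: graph_hom_def)

lemma graph_hom_comp:
  "graph_hom R A B f \<Longrightarrow> graph_hom R B C g \<Longrightarrow> graph_hom R A C (\<lambda>x. g (f x))"
  by (auto simp: graph_hom_def Pi_iff)

lemma graph_hom_funpow: "graph_hom R A A f \<Longrightarrow> graph_hom R A A (f ^^ k)"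
  by (induction k) (auto simp: graph_hom_def Pi_iff)

lemma graph_retract_refl: "graph_retract R A A"
  by (auto simp: graph_retract_def graph_hom_def intro!: exI[of _ id])

lemma graph_retract_trans:
  assumes "graph_retract R A B" "graph_retract R B C"
  shows "graph_retract R A C"
proof -
  obtain \<rho> \<sigma> where \<rho>: "graph_hom R A B \<rho>" "\<forall>x\<in>B. \<rho> x = x"
    and \<sigma>: "graph_hom R B C \<sigma>" "\<forall>x\<in>C. \<sigma> x = x"
    and sub: "B \<subseteq> A" "C \<subseteq> B"
    using assms unfolding graph_retract_def by blast
  have "graph_hom R A C (\<lambda>x. \<sigma> (\<rho> x))" by (rule graph_hom_comp[OF \<rho>(1) \<sigma>(1)])
  moreover have "\<forall>x\<in>C. \<sigma> (\<rho> x) = x" using \<rho>(2) \<sigma>(2) sub by auto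
  ultimately show ?thesis using sub unfolding graph_retract_def by blast
qed

text \<open>
  The powers of \<open>f\<close> on the finite set \<open>A\<close> repeat, so they are eventually periodic; a multiple of the
  period that is past the preperiod is the exponent of an idempotent.
\<close>

lemma idempotent_power:
  fixes f :: "'a \<Rightarrow> 'a"
  assumes "finite A" "f \<in> A \<rightarrow> A"
  obtains m where "m > 0" "\<And>x. x \<in> A \<Longrightarrow> (f ^^ m) ((f ^^ m) x) = (f ^^ m) x"
proof -
  have mem: "(f ^^ k) x \<in> A" if "x \<in> A" for k x
    using that assms(2) by (induction k) auto
  have "finite (A \<rightarrow>\<^sub>E A)" using assms(1) by (simp add: finite_PiE)
  moreover have "range (\<lambda>k. restrict (f ^^ k) A) \<subseteq> A \<rightarrow>\<^sub>E A" using mem by auto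
  ultimately have "\<not> inj (\<lambda>k::nat. restrict (f ^^ k) A)"
    using finite_subset finite_imageD infinite_UNIV_nat by blast
  then obtain i j :: nat where ij: "i < j" "restrict (f ^^ i) A = restrict (f ^^ j) A"
    unfolding inj_def by (metis linorder_neqE_nat)
  define d where "d = j - i"
  have base: "(f ^^ (i + d)) x = (f ^^ i) x" if "x \<in> A" for x
    using fun_cong[OF ij(2), of x] that ij(1) by (simp add: d_def)
  have per: "(f ^^ (n + d)) x = (f ^^ n) x" if "x \<in> A" "n \<ge> i" for x n
  proof -
    obtain l where n: "n = l + i" using \<open>n \<ge> i\<close> by (metis add.commute le_Suc_ex)
    have "(f ^^ (n + d)) x = (f ^^ l) ((f ^^ (i + d)) x)"
      by (simp add: n funpow_add)
    also have "\<dots> = (f ^^ n) x" unfolding base[OF that(1)] by (simp add: n funpow_add)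
    finally show ?thesis .
  qed
  have mult: "(f ^^ (n + k * d)) x = (f ^^ n) x" if "x \<in> A" "n \<ge> i" for x n k
  proof (induction k)
    case (Suc k)
    have "(f ^^ (n + Suc k * d)) x = (f ^^ ((n + k * d) + d)) x" by (simp add: algebra_simps)
    also have "\<dots> = (f ^^ (n + k * d)) x" using per that by simp
    finally show ?case using Suc by simp
  qed simp
  \<comment> \<open>The factor is \<open>Suc i\<close> rather than \<open>i\<close> to keep the exponent positive when \<open>i = 0\<close>.\<close>
  define m where "m = Suc i * d"
  have d: "d > 0" using ij(1) by (simp add: d_def)
  have m: "m > 0" "m \<ge> i" using d mult_le_mono2[of 1 d "Suc i"] by (simp_all add: m_def)
  show ?thesis
  proof
    fix x assume "x \<in> A"
    from mult[OF this m(2), of "Suc i"] show "(f ^^ m) ((f ^^ m) x) = (f ^^ m) x"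
      unfolding m_def[symmetric] by (simp add: funpow_add)
  qed (fact m(1))
qed

text \<open>
  The retract is the image of an idempotent power of \<open>f\<close>. It is mapped into itself by \<open>f\<close>, which
  commutes with its own powers, and it lies inside the image of \<open>f\<close>, hence is smaller than \<open>C\<close>.
\<close>

lemma approx_free_not_onto_shrinks:
  assumes "finite C" "approx_free R C f" "f ` C \<noteq> C"
  obtains D where "D \<subset> C" "graph_retract R C D" "approx_free R D f"
proof -
  have hom: "graph_hom R C C f" and free: "\<forall>x\<in>C. \<not> R (f x) x"
    using assms(2) unfolding approx_free_def by blast+
  obtain m where m: "m > 0" "\<And>x. x \<in> C \<Longrightarrow> (f ^^ m) ((f ^^ m) x) = (f ^^ m) x"
    using idempotent_power[OF assms(1)] hom unfolding graph_hom_def by blast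
  define D where "D = (f ^^ m) ` C"
  have homm: "graph_hom R C C (f ^^ m)" by (rule graph_hom_funpow[OF hom])
  obtain l where l: "m = Suc l" using m(1) gr0_implies_Suc by blast
  have "D \<subseteq> f ` C"
    using graph_hom_mem[OF graph_hom_funpow[OF hom, of l]] by (auto simp: D_def l)
  moreover have fC: "f ` C \<subseteq> C" using graph_hom_mem[OF hom] by blast
  ultimately have D: "D \<subset> C" using assms(3) by blast
  have "graph_hom R C D (f ^^ m)" using homm by (auto simp: graph_hom_def D_def)
  moreover have "\<forall>x\<in>D. (f ^^ m) x = x" using m(2) by (auto simp: D_def)
  ultimately have ret: "graph_retract R C D" using D unfolding graph_retract_def by blast
  have "f x \<in> D" if "x \<in> D" for x
  proof -
    obtain z where z: "z \<in> C" "x = (f ^^ m) z"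
      using \<open>x \<in> D\<close> unfolding D_def by blast
    have "f x = (f ^^ m) (f z)" using z(2) by (simp add: funpow_swap1)
    then show ?thesis using z(1) fC by (auto simp: D_def)
  qed
  then have "approx_free R D f"
    using D hom free unfolding approx_free_def graph_hom_def by blast
  with D ret show ?thesis by (rule that)
qed

section \<open>Foldings preserve the approximate fixed point property\<close>

text \<open>
  Here \<open>y\<close> dominates \<open>x\<close> in \<open>C\<close>. Precomposing \<open>f\<close> with the map that moves \<open>x\<close> to \<open>y\<close> creates no
  approximate fixed point: if \<open>f y\<close> were close to \<open>x\<close>, it would be close to \<open>y\<close> by domination. The
  composition misses a point of \<open>C\<close> because \<open>x\<close> no longer contributes to the image.
\<close>

lemma approx_free_dominated_shrinks:
  assumes "finite C" "reflp_on C R" "symp_on C R" "approx_free R C f"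
    and x: "x \<in> C" and y: "y \<in> C" and ne: "x \<noteq> y"
    and dom: "\<And>z. z \<in> C \<Longrightarrow> R x z \<Longrightarrow> R y z"
  obtains D g where "D \<subset> C" "graph_retract R C D" "approx_free R D g"
proof -
  have hom: "graph_hom R C C f" and free: "\<forall>x\<in>C. \<not> R (f x) x"
    using assms(4) unfolding approx_free_def by blast+
  have sym: "R u w" if "R w u" "u \<in> C" "w \<in> C" for u w
    using assms(3) that unfolding symp_on_def by blast
  define \<phi> where "\<phi> = (\<lambda>z. if z = x then y else z)"
  have "graph_hom R C C \<phi>"
    unfolding graph_hom_def
  proof (intro conjI ballI impI)
    show "\<phi> \<in> C \<rightarrow> C" using y by (simp add: \<phi>_def)
    fix u w assume uw: "u \<in> C" "w \<in> C" "R u w"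
    have "R y y" using assms(2) y unfolding reflp_on_def by blast
    then show "R (\<phi> u) (\<phi> w)"
      using uw dom[of w] sym[OF _ x uw(1)] dom[of u] sym[OF _ uw(1) y]
      by (auto simp: \<phi>_def)
  qed
  then have hom': "graph_hom R C C (\<lambda>z. f (\<phi> z))" using hom by (rule graph_hom_comp)
  have "\<not> R (f (\<phi> z)) z" if z: "z \<in> C" for z
  proof (cases "z = x")
    case True
    have fy: "f y \<in> C" using graph_hom_mem[OF hom y] .
    have "\<not> R (f y) x"
      using sym[of "f y" x] sym[of y "f y"] dom[OF fy] free fy x y by blast
    then show ?thesis using True by (simp add: \<phi>_def)
  next
    case False
    then show ?thesis using z free by (simp add: \<phi>_def)
  qed
  with hom' have free': "approx_free R C (\<lambda>z. f (\<phi> z))" unfolding approx_free_def by blast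
  have "(\<lambda>z. f (\<phi> z)) ` C \<subseteq> f ` (C - {x})" using y ne by (auto simp: \<phi>_def)
  then have "card ((\<lambda>z. f (\<phi> z)) ` C) \<le> card (f ` (C - {x}))"
    using assms(1) by (intro card_mono) auto
  also have "\<dots> \<le> card (C - {x})" using assms(1) by (intro card_image_le) auto
  also have "\<dots> < card C" using assms(1) x by (intro psubset_card_mono) auto
  finally have "(\<lambda>z. f (\<phi> z)) ` C \<noteq> C" by auto
  with assms(1) free' show ?thesis by (rule approx_free_not_onto_shrinks) (rule that)
qed

text \<open>
  Conjugating by \<open>r\<close> and \<open>\<rho>\<close> transfers approximate fixed points faithfully only because
  \<open>\<rho> \<circ> r\<close> is the identity on \<open>C\<close>; the minimal choice of \<open>C\<close> is what guarantees this.
\<close>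

lemma approx_fixed_folding:
  assumes "finite V" "reflp_on V R" "symp_on V R" "W \<subseteq> V"
    and r: "r \<in> V \<rightarrow> W"
    and fold: "\<And>x y. x \<in> V \<Longrightarrow> y \<in> V \<Longrightarrow> R x y \<Longrightarrow> R (r x) y"
    and W: "\<nexists>g. approx_free R W g"
  shows "\<nexists>f. approx_free R V f"
proof
  assume ex: "\<exists>f. approx_free R V f"
  define \<C> where "\<C> = {C. graph_retract R V C \<and> (\<exists>f. approx_free R C f)}"
  have "\<C> \<subseteq> Pow V" by (auto simp: \<C>_def graph_retract_def)
  then have "finite \<C>" using assms(1) finite_subset by blast
  moreover have "V \<in> \<C>" using ex graph_retract_refl by (auto simp: \<C>_def)
  ultimately obtain C where C: "C \<in> \<C>" and min: "\<And>D. D \<in> \<C> \<Longrightarrow> D \<subseteq> C \<Longrightarrow> D = C"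
    using finite_has_minimal[of \<C>] by blast
  obtain f \<rho> where free: "approx_free R C f" and CV: "C \<subseteq> V"
    and \<rho>: "graph_hom R V C \<rho>" "\<forall>x\<in>C. \<rho> x = x"
    using C unfolding \<C>_def graph_retract_def by blast
  have hom: "graph_hom R C C f" using free unfolding approx_free_def by blast
  have sym: "R u w" if "R w u" "u \<in> V" "w \<in> V" for u w
    using assms(3) that unfolding symp_on_def by blast
  have rV: "r x \<in> V" if "x \<in> V" for x using that r assms(4) by blast
  have id: "\<rho> (r x) = x" if x: "x \<in> C" for x
  proof (rule ccontr)
    assume ne: "\<rho> (r x) \<noteq> x"
    have y: "\<rho> (r x) \<in> C" using graph_hom_mem[OF \<rho>(1)] rV CV x by blast
    have dom: "R (\<rho> (r x)) z" if z: "z \<in> C" "R x z" for z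
    proof -
      have "R (\<rho> (r x)) (\<rho> z)"
        using graph_hom_rel[OF \<rho>(1)] fold[of x z] rV x z CV by blast
      then show ?thesis using \<rho>(2) z(1) by simp
    qed
    have fin: "finite C" using assms(1) CV finite_subset by blast
    have rs: "reflp_on C R" "symp_on C R"
      using assms(2,3) CV by (auto intro: reflp_on_subset symp_on_subset)
    obtain D g where D: "D \<subset> C" "graph_retract R C D" "approx_free R D g"
      using approx_free_dominated_shrinks[OF fin rs free x y ne[symmetric] dom] by blast
    have "graph_retract R V C" using C unfolding \<C>_def by blast
    then have "D \<in> \<C>" using D(2,3) graph_retract_trans unfolding \<C>_def by blast
    then show False using min D(1) by blast
  qed
  have "graph_hom R V W r"
    unfolding graph_hom_def
  proof (intro conjI ballI impI)
    show "r \<in> V \<rightarrow> W" by (fact r)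
    fix x y assume xy: "x \<in> V" "y \<in> V" "R x y"
    then show "R (r x) (r y)" using fold[of x y] fold[of y "r x"] sym rV by blast
  qed
  then have "graph_hom R C W r" using CV unfolding graph_hom_def by blast
  have "graph_hom R W C \<rho>" using \<rho>(1) assms(4) unfolding graph_hom_def by blast
  from graph_hom_comp[OF graph_hom_comp[OF this hom] \<open>graph_hom R C W r\<close>]
  have "graph_hom R W W (\<lambda>z. r (f (\<rho> z)))" .
  moreover have "\<not> R (r (f (\<rho> z))) z" if z: "z \<in> W" for z
  proof
    assume "R (r (f (\<rho> z))) z"
    have zC: "\<rho> z \<in> C" using graph_hom_mem[OF \<rho>(1)] z assms(4) by blast
    then have fC: "f (\<rho> z) \<in> C" using graph_hom_mem[OF hom] by blast
    have "R (\<rho> (r (f (\<rho> z)))) (\<rho> z)"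
      using graph_hom_rel[OF \<rho>(1)] \<open>R (r (f (\<rho> z))) z\<close> rV fC CV z assms(4) by blast
    then have "R (f (\<rho> z)) (\<rho> z)" using id[OF fC] by simp
    then show False using free zC unfolding approx_free_def by blast
  qed
  ultimately have "approx_free R W (\<lambda>z. r (f (\<rho> z)))" unfolding approx_free_def by blast
  then show False using W by blast
qed

section \<open>Continuity as preservation of closeness\<close>

lemma dig_connected_pair_adjacent:
  assumes "dig_connected \<kappa> {x, y}"
  shows "\<kappa> x y \<or> x = y"
proof (rule ccontr)
  assume no: "\<not> (\<kappa> x y \<or> x = y)"
  obtain k :: nat and p where p: "p 0 = x" "p k = y" "\<forall>i\<le>k. p i \<in> {x, y}"
      "\<forall>i<k. \<kappa> (p i) (p (Suc i)) \<or> p i = p (Suc i)"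
    using bspec[OF bspec[OF assms[unfolded dig_connected_def], of x], of y]
    by auto
  \<comment> \<open>The first step away from \<open>x\<close> would go to \<open>y\<close>, so the path can never leave \<open>x\<close>.\<close>
  have "p i = x" if "i \<le> k" for i
    using that
  proof (induction i)
    case (Suc i)
    then have "p i = x" "p (Suc i) = x \<or> p (Suc i) = y" using p(3) by auto
    moreover have "\<kappa> (p i) (p (Suc i)) \<or> p i = p (Suc i)" using p(4) Suc.prems by simp
    ultimately show ?case using no by auto
  qed (simp add: p)
  then show False using p(2) no by auto
qed

lemma dig_connected_adjacent_pair:
  assumes "\<kappa> x y" "\<kappa> y x"
  shows "dig_connected \<kappa> {x, y}"
proof -
  have "\<exists>(k::nat) p. p 0 = u \<and> p k = w \<and> (\<forall>i\<le>k. p i \<in> {x, y}) \<and>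
      (\<forall>i<k. \<kappa> (p i) (p (Suc i)) \<or> p i = p (Suc i))"
    if "u \<in> {x, y}" "w \<in> {x, y}" for u w
    using that assms by (intro exI[of _ 1] exI[of _ "\<lambda>i. if i = 0 then u else w"]) auto
  then show ?thesis unfolding dig_connected_def by blast
qed

lemma dig_continuous_iff_graph_hom:
  assumes "symp_on X \<kappa>" "f \<in> X \<rightarrow> X"
  shows "dig_continuous X \<kappa> f \<longleftrightarrow> graph_hom (\<lambda>x y. \<kappa> x y \<or> x = y) X X f"
proof
  assume c: "dig_continuous X \<kappa> f"
  have "\<kappa> (f x) (f y) \<or> f x = f y" if xy: "x \<in> X" "y \<in> X" "\<kappa> x y" for x y
  proof -
    have "\<kappa> y x" using assms(1) xy unfolding symp_on_def by blast
    with xy(3) have "dig_connected \<kappa> {x, y}" by (rule dig_connected_adjacent_pair)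
    moreover have "{x, y} \<subseteq> X" using xy by simp
    ultimately have "dig_connected \<kappa> (f ` {x, y})"
      using c unfolding dig_continuous_def by metis
    then show ?thesis by (intro dig_connected_pair_adjacent) simp
  qed
  then show "graph_hom (\<lambda>x y. \<kappa> x y \<or> x = y) X X f"
    using assms(2) unfolding graph_hom_def by blast
next
  assume h: "graph_hom (\<lambda>x y. \<kappa> x y \<or> x = y) X X f"
  show "dig_continuous X \<kappa> f"
    unfolding dig_continuous_def
  proof (intro allI impI)
    fix A assume A: "A \<subseteq> X" "dig_connected \<kappa> A"
    show "dig_connected \<kappa> (f ` A)"
      unfolding dig_connected_def
    proof (intro ballI)
      fix u w assume "u \<in> f ` A" "w \<in> f ` A"
      then obtain x y where xy: "x \<in> A" "y \<in> A" "u = f x" "w = f y" by blast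
      obtain k :: nat and p where p: "p 0 = x" "p k = y" "\<forall>i\<le>k. p i \<in> A"
          "\<forall>i<k. \<kappa> (p i) (p (Suc i)) \<or> p i = p (Suc i)"
        using A(2) xy(1,2) unfolding dig_connected_def by blast
      have "\<kappa> (f (p i)) (f (p (Suc i))) \<or> f (p i) = f (p (Suc i))" if "i < k" for i
      proof -
        have "p i \<in> X" "p (Suc i) \<in> X" using p(3) A(1) that by auto
        then show ?thesis using graph_hom_rel[OF h] p(4) that by blast
      qed
      then show "\<exists>(k::nat) p. p 0 = u \<and> p k = w \<and> (\<forall>i\<le>k. p i \<in> f ` A) \<and>
          (\<forall>i<k. \<kappa> (p i) (p (Suc i)) \<or> p i = p (Suc i))"
        using p xy(3,4) by (intro exI[of _ k] exI[of _ "\<lambda>i. f (p i)"]) auto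
    qed
  qed
qed

lemma AFPP_iff_not_approx_free:
  assumes "symp_on X \<kappa>"
  shows "AFPP X \<kappa> \<longleftrightarrow> (\<nexists>f. approx_free (\<lambda>x y. \<kappa> x y \<or> x = y) X f)"
proof -
  have "f \<in> X \<rightarrow> X \<and> dig_continuous X \<kappa> f \<longleftrightarrow> graph_hom (\<lambda>x y. \<kappa> x y \<or> x = y) X X f" for f
    using dig_continuous_iff_graph_hom[OF assms, of f] unfolding graph_hom_def by blast
  moreover have "AFPP X \<kappa> \<longleftrightarrow>
      (\<forall>f. f \<in> X \<rightarrow> X \<and> dig_continuous X \<kappa> f \<longrightarrow> (\<exists>x\<in>X. \<kappa> (f x) x \<or> f x = x))"
    unfolding AFPP_def by blast
  ultimately show ?thesis by (simp add: approx_free_def)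
qed

section \<open>Shrinking the box\<close>

lemma c_adj_full_or_eq_iff:
  assumes "y \<in> int_lattice v" "y' \<in> int_lattice v"
  shows "c_adj v v y y' \<or> y = y' \<longleftrightarrow> (\<forall>i\<in>{1..v}. \<bar>y i - y' i\<bar> \<le> 1)"
proof
  assume "c_adj v v y y' \<or> y = y'"
  then have "\<bar>y i - y' i\<bar> = 1 \<or> y i = y' i" if "i \<in> {1..v}" for i
    using that unfolding c_adj_def by blast
  then show "\<forall>i\<in>{1..v}. \<bar>y i - y' i\<bar> \<le> 1" by fastforce
next
  assume le: "\<forall>i\<in>{1..v}. \<bar>y i - y' i\<bar> \<le> 1"
  have "card {i \<in> {1..v}. \<bar>y i - y' i\<bar> = 1} \<le> v"
  proof -
    have "card {i \<in> {1..v}. \<bar>y i - y' i\<bar> = 1} \<le> card {1..v}" by (rule card_mono) auto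
    then show ?thesis by simp
  qed
  moreover have "y j = y' j" if "j \<in> {1..v}" "\<bar>y j - y' j\<bar> \<noteq> 1" for j
    using bspec[OF le that(1)] that(2) by linarith
  ultimately show "c_adj v v y y' \<or> y = y'" using assms unfolding c_adj_def by blast
qed

lemma int_box_subset_lattice: "int_box v a b \<subseteq> int_lattice v"
  using digital_image_box unfolding digital_image_def by blast

lemma NP_or_eq_iff:
  assumes "y \<in> int_box v a b" "y' \<in> int_box v a b"
  shows "NP \<kappa> (c_adj v v) (x, y) (x', y') \<or> (x, y) = (x', y') \<longleftrightarrow>
    (\<kappa> x x' \<or> x = x') \<and> (\<forall>i\<in>{1..v}. \<bar>y i - y' i\<bar> \<le> 1)"
proof -
  have "y \<in> int_lattice v" "y' \<in> int_lattice v"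
    using assms int_box_subset_lattice by blast+
  from c_adj_full_or_eq_iff[OF this] show ?thesis unfolding NP_def by auto
qed

lemma approx_fixed_times_point:
  assumes "\<nexists>g. approx_free (\<lambda>x y. \<kappa> x y \<or> x = y) X g"
  shows "\<nexists>f. approx_free (\<lambda>p q. NP \<kappa> l p q \<or> p = q) (X \<times> {c}) f"
proof
  assume "\<exists>f. approx_free (\<lambda>p q. NP \<kappa> l p q \<or> p = q) (X \<times> {c}) f"
  then obtain f where hom: "graph_hom (\<lambda>p q. NP \<kappa> l p q \<or> p = q) (X \<times> {c}) (X \<times> {c}) f"
    and free: "\<And>x. x \<in> X \<Longrightarrow> \<not> (NP \<kappa> l (f (x, c)) (x, c) \<or> f (x, c) = (x, c))"
    unfolding approx_free_def by blast
  define g where "g = (\<lambda>x. fst (f (x, c)))"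
  have f: "f (x, c) = (g x, c)" "g x \<in> X" if "x \<in> X" for x
    using graph_hom_mem[OF hom, of "(x, c)"] that by (auto simp: g_def mem_Times_iff prod_eq_iff)
  have "\<kappa> (g x) (g y) \<or> g x = g y" if "x \<in> X" "y \<in> X" "\<kappa> x y \<or> x = y" for x y
  proof -
    have "NP \<kappa> l (f (x, c)) (f (y, c)) \<or> f (x, c) = f (y, c)"
      using graph_hom_rel[OF hom, of "(x, c)" "(y, c)"] that by (auto simp: NP_def)
    then show ?thesis using f(1) that(1,2) by (auto simp: NP_def)
  qed
  moreover have "\<not> (\<kappa> (g x) x \<or> g x = x)" if "x \<in> X" for x
    using free[OF that] f(1)[OF that] by (auto simp: NP_def)
  ultimately have "approx_free (\<lambda>x y. \<kappa> x y \<or> x = y) X g"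
    using f(2) unfolding approx_free_def graph_hom_def by blast
  then show False using assms by blast
qed

text \<open>
  The box is truncated to sides of length at most \<open>N\<close>. Lowering \<open>N\<close> by one cuts off the top layer in
  every direction that is long enough; a point close to a top point differs by at most one from the
  truncated value as well, so this is a folding.
\<close>

lemma approx_fixed_times_truncated_box:
  fixes X :: "'a set" and \<kappa> :: "'a \<Rightarrow> 'a \<Rightarrow> bool"
  assumes "finite X" "symp_on X \<kappa>" "\<forall>i\<in>{1..v}. a i \<le> b i"
    and X: "\<nexists>g. approx_free (\<lambda>x y. \<kappa> x y \<or> x = y) X g"
  shows "\<nexists>f. approx_free (\<lambda>p q. NP \<kappa> (c_adj v v) p q \<or> p = q)
    (X \<times> int_box v a (\<lambda>i. min (b i) (a i + int N))) f"
proof (induction N)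
  case 0
  have "min (b i) (a i) = a i" if "i \<in> {1..v}" for i using assms(3) that by auto
  then have "int_box v a (\<lambda>i. min (b i) (a i + int 0)) = (\<Pi>\<^sub>E i\<in>{1..v}. {a i})"
    unfolding int_box_def by (intro PiE_cong) auto
  also have "\<dots> = {\<lambda>i\<in>{1..v}. a i}" by (simp add: PiE_eq_singleton)
  finally show ?case using approx_fixed_times_point[OF X] by simp
next
  case (Suc N)
  define B where "B = (\<lambda>N. int_box v a (\<lambda>i. min (b i) (a i + int N)))"
  define R where "R = (\<lambda>p q. NP \<kappa> (c_adj v v) p q \<or> p = q)"
  define cut where "cut = (\<lambda>y. \<lambda>i\<in>{1..v}. min (y i) (a i + int N))"
  have sub: "B N \<subseteq> B (Suc N)" unfolding B_def int_box_def by (intro PiE_mono) auto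
  have cut: "cut y \<in> B N" if "y \<in> B (Suc N)" for y
    unfolding B_def int_box_def
  proof (rule PiE_I)
    fix i assume i: "i \<in> {1..v}"
    have "y i \<in> {a i..min (b i) (a i + int (Suc N))}"
      using that i unfolding B_def int_box_def by (rule PiE_mem)
    then show "cut y i \<in> {a i..min (b i) (a i + int N)}" using i by (auto simp: cut_def)
  qed (auto simp: cut_def)
  have R: "R (x, y) (x', y') \<longleftrightarrow> (\<kappa> x x' \<or> x = x') \<and> (\<forall>i\<in>{1..v}. \<bar>y i - y' i\<bar> \<le> 1)"
    if "y \<in> B (Suc N)" "y' \<in> B (Suc N)" for x x' y y'
    using that unfolding R_def B_def by (rule NP_or_eq_iff)
  have fold: "R (map_prod id cut p) q"
    if p: "p \<in> X \<times> B (Suc N)" and q: "q \<in> X \<times> B (Suc N)" and "R p q" for p q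
  proof -
    obtain x y x' y' where e: "p = (x, y)" "q = (x', y')" by (metis surj_pair)
    have y: "y \<in> B (Suc N)" "y' \<in> B (Suc N)" using p q e by auto
    have close: "\<kappa> x x' \<or> x = x'" "\<forall>i\<in>{1..v}. \<bar>y i - y' i\<bar> \<le> 1"
      using \<open>R p q\<close> unfolding e R[OF y] by blast+
    have "\<bar>cut y i - y' i\<bar> \<le> 1" if i: "i \<in> {1..v}" for i
    proof -
      have "y' i \<in> {a i..min (b i) (a i + int (Suc N))}"
        using y(2) i unfolding B_def int_box_def by (rule PiE_mem)
      then show ?thesis using bspec[OF close(2) i] i by (auto simp: cut_def)
    qed
    with close(1) have "R (x, cut y) (x', y')" using R cut[OF y(1)] sub y(2) by blast
    then show ?thesis by (simp add: e)
  qed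
  have "finite (B (Suc N))" unfolding B_def int_box_def by (intro finite_PiE) auto
  then have fin: "finite (X \<times> B (Suc N))" using assms(1) by simp
  have refl: "reflp_on (X \<times> B (Suc N)) R" by (simp add: R_def reflp_on_def)
  have sym: "symp_on (X \<times> B (Suc N)) R"
  proof (rule symp_onI)
    fix p q assume p: "p \<in> X \<times> B (Suc N)" and q: "q \<in> X \<times> B (Suc N)" and "R p q"
    obtain x y x' y' where e: "p = (x, y)" "q = (x', y')" by (metis surj_pair)
    have m: "x \<in> X" "x' \<in> X" "y \<in> B (Suc N)" "y' \<in> B (Suc N)" using p q e by auto
    have close: "\<kappa> x x' \<or> x = x'" "\<forall>i\<in>{1..v}. \<bar>y i - y' i\<bar> \<le> 1"
      using \<open>R p q\<close> unfolding e R[OF m(3,4)] by blast+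
    have "\<kappa> x' x \<or> x' = x" using close(1) assms(2) m unfolding symp_on_def by blast
    moreover have "\<forall>i\<in>{1..v}. \<bar>y' i - y i\<bar> \<le> 1"
      using close(2) by (simp only: abs_minus_commute)
    ultimately show "R q p" unfolding e R[OF m(4,3)] by blast
  qed
  have "\<nexists>f. approx_free R (X \<times> B (Suc N)) f"
  proof (rule approx_fixed_folding[OF fin refl sym _ _ fold])
    show "X \<times> B N \<subseteq> X \<times> B (Suc N)" using sub by auto
    show "map_prod id cut \<in> X \<times> B (Suc N) \<rightarrow> X \<times> B N" using cut by auto
    show "\<nexists>g. approx_free R (X \<times> B N) g" using Suc unfolding R_def B_def .
  qed
  then show ?case unfolding R_def B_def .
qed

theorem theorem4p8:
  fixes X :: "(nat \<Rightarrow> int) set" and \<kappa> :: "(nat \<Rightarrow> int) \<Rightarrow> (nat \<Rightarrow> int) \<Rightarrow> bool"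
    and n v :: nat and a b :: "nat \<Rightarrow> int"
  assumes "digital_image n X \<kappa>" and "finite X" and "AFPP X \<kappa>"
    and "v \<ge> 1" and "\<forall>i\<in>{1..v}. a i \<le> b i"
  shows "AFPP (X \<times> int_box v a b) (NP \<kappa> (c_adj v v))"
proof -
  have adj: "adjacency_on X \<kappa>" using assms(1) unfolding digital_image_def by blast
  then have sym: "symp_on X \<kappa>" unfolding adjacency_on_def by blast
  have "adjacency_on (int_box v a b) (c_adj v v)"
    using digital_image_box unfolding digital_image_def by blast
  with adj have symP: "symp_on (X \<times> int_box v a b) (NP \<kappa> (c_adj v v))"
    using adjacency_on_NP unfolding adjacency_on_def by blast
  \<comment> \<open>Truncating at the sum of all side lengths leaves the box unchanged.\<close>
  define N where "N = (\<Sum>i\<in>{1..v}. nat (b i - a i))"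
  have "min (b i) (a i + int N) = b i" if i: "i \<in> {1..v}" for i
  proof -
    have "nat (b i - a i) \<le> N" unfolding N_def using i by (intro member_le_sum) auto
    then show ?thesis by linarith
  qed
  then have box: "int_box v a (\<lambda>i. min (b i) (a i + int N)) = int_box v a b"
    unfolding int_box_def by (intro PiE_cong) auto
  have "\<nexists>g. approx_free (\<lambda>x y. \<kappa> x y \<or> x = y) X g"
    using assms(3) AFPP_iff_not_approx_free[OF sym] by blast
  from approx_fixed_times_truncated_box[OF assms(2) sym assms(5) this, of N]
  show ?thesis unfolding box AFPP_iff_not_approx_free[OF symP] .
qed

end
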